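(* Let $n\ge m$ be positive integers, $A\in\mathbb{R}^{n\times n}$, $B\in\mathbb{R}^{n\times m}$, $\Phi$ a real symmetric $n\times n$ matrix with $\Phi>0$, $\gamma>0$ real, and let $M$ be a real symmetric $n\times n$ matrix satisfying the standing assumptions on $M$ listed in the context. Then, for any $k\in\mathbb{N}$, the elements $\Lambda_k$ and $\Theta_k$ of the max-plus primal and dual space fundamental solution semigroups $\{\Lambda_k,k\in\mathbb{N}\}$ and $\{\Theta_k,k\in\mathbb{N}\}$ (respectively) satisfy $$\Lambda_k=\Xi(\Theta_k).$$
   Context: $\mathbb{N}=\{1,2,\dots\}$. $\mathbb{M}^{n\times n}$ denotes the real symmetric $n\times n$ matrices; $P>0$ ($P\ge0$) means positive (semi)definite, $P>Q$ means $P-Q>0$, and $P<0$ means $-P>0$. Riccati operator: $\mathcal{R}(P)=\Phi+A^TPA+A^TPB(\gamma^2I-B^TPB)^{-1}B^TPA$ for $P\in\mathbb{M}^{n\times n}$; $\mathcal{R}_0$ is the identity and $\mathcal{R}_{k+1}=\mathcal{R}\circ\mathcal{R}_k$. Standing assumptions on $M\in\mathbb{M}^{n\times n}$: (i) $\gamma^2I-B^T\mathcal{R}_k(M)B>0$ for all integers $k\ge0$; (ii) $\mathcal{R}(M)-M>0$; (iii) $MB(\gamma^2I-B^TMB)^{-1}B^TM>0$. Dynamic programming evolution operators: $(\mathcal{S}\phi)(x)=\sup_{w\in\mathbb{R}^m}\{\frac12x^T\Phi x-\frac{\gamma^2}{2}|w|^2+\phi(Ax+Bw)\}$, $\mathcal{S}_0$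 is the identity, and $\mathcal{S}_{k+1}\phi=\mathcal{S}(\mathcal{S}_k\phi)$. $\psi(x,z)=\frac12(x-z)^TM(x-z)$ for $x,z\in\mathbb{R}^n$, and $(\mathcal{D}_\psi\phi)(z)=-\sup_{x\in\mathbb{R}^n}\{\psi(x,z)-\phi(x)\}$. Auxiliary value function: $\widehat{\mathrm{S}}_k(x,z)=(\mathcal{S}_k\psi(\cdot,z))(x)$. For $k\in\mathbb{N}$ define the dual space kernel $\mathrm{B}_k(y,z)=(\mathcal{D}_\psi\widehat{\mathrm{S}}_k(\cdot,z))(y)=-\sup_{x\in\mathbb{R}^n}\{\psi(x,y)-\widehat{\mathrm{S}}_k(x,z)\}$ and the primal space kernel $\mathrm{S}_k(x,y)=(\mathcal{D}_\psi\widehat{\mathrm{S}}_k(x,\cdot))(y)=-\sup_{z\in\mathbb{R}^n}\{\psi(z,y)-\widehat{\mathrm{S}}_k(x,z)\}$. Under the assumptions on $M$, both are real-valued quadratic forms $$\mathrm{B}_k(y,z)=\frac12\begin{bmatrix} y \\ z \end{bmatrix}^T\Theta_k\begin{bmatrix} y \\ z \end{bmatrix},\qquad \mathrm{S}_k(x,y)=\frac12\begin{bmatrix} x \\ y \end{bmatrix}^T\Lambda_k\begin{bmatrix} x \\ y \end{bmatrix},$$ with $\Theta_k,\Lambda_k\in\mathbb{M}^{2n\times2n}$; this defines $\Theta_k$ and $\Lambda_k$. The families $\{\Theta_k\}$ and $\{\Lambda_k\}$ are called the max-plus dual and primal space fundamental solution semigroups. Write $\Omega\in\mathbb{M}^{2n\times2n}$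 in $n\times n$ blocks $\Omega=\begin{bmatrix}\Omega^{11}&\Omega^{12} \\ \Omega^{21}&\Omega^{22}\end{bmatrix}$. Define: for $\Omega$ with $\Omega^{11}+M<0$, $$\Gamma(\Omega)=\begin{bmatrix}M-M(M+\Omega^{11})^{-1}M&M(M+\Omega^{11})^{-1}\Omega^{12} \\ \Omega^{21}(M+\Omega^{11})^{-1}M&\Omega^{22}-\Omega^{21}(M+\Omega^{11})^{-1}\Omega^{12}\end{bmatrix};$$ for every $\Omega$, $\Delta(\Omega)=\begin{bmatrix}\Omega^{22}&\Omega^{21} \\ \Omega^{12}&\Omega^{11}\end{bmatrix}$; and $\Pi=\Delta\circ\Gamma\circ\Delta$ (defined for $\Omega$ with $\Omega^{22}+M<0$). The inverse of $\Pi$ is $\Pi^{-1}(\Omega)=-\Pi(-\Omega)$, defined for $\Omega$ with $M-\Omega^{22}<0$. Finally, $\Xi=\Pi^{-1}\circ\Gamma$. *)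

theory Defs
  imports "HOL-Analysis.Analysis"
begin

definition sym_mat :: "real^'n^'n \<Rightarrow> bool" where
  "sym_mat P \<longleftrightarrow> transpose P = P"

(* The order on matrices is only used for symmetric ones, so symmetry is part of P > 0. *)
definition pos_def :: "real^'n^'n \<Rightarrow> bool" where
  "pos_def P \<longleftrightarrow> sym_mat P \<and> (\<forall>x. x \<noteq> 0 \<longrightarrow> x \<bullet> (P *v x) > 0)"

definition neg_def :: "real^'n^'n \<Rightarrow> bool" where
  "neg_def P \<longleftrightarrow> pos_def (- P)"

(* mat c is the scalar matrix c I. *)
definition riccati ::
  "real^'n^'n \<Rightarrow> real^'m^'n \<Rightarrow> real^'n^'n \<Rightarrow> real \<Rightarrow> real^'n^'n \<Rightarrow> real^'n^'n" where
  "riccati A B \<Phi> \<gamma> P =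
     \<Phi> + transpose A ** P ** A
       + transpose A ** P ** B ** matrix_inv (mat (\<gamma>\<^sup>2) - transpose B ** P ** B)
           ** transpose B ** P ** A"

(* Functions take values in the extended reals so that all suprema are genuine.  The
   indeterminate form \<infinity> - \<infinity> never occurs below: one summand is always a real number. *)
definition dp_op ::
  "real^'n^'n \<Rightarrow> real^'m^'n \<Rightarrow> real^'n^'n \<Rightarrow> real
     \<Rightarrow> (real^'n \<Rightarrow> ereal) \<Rightarrow> real^'n \<Rightarrow> ereal" where
  "dp_op A B \<Phi> \<gamma> \<phi> x =
     (SUP w. ereal (1/2 * (x \<bullet> (\<Phi> *v x)) - \<gamma>\<^sup>2 / 2 * (norm w)\<^sup>2) + \<phi> (A *v x + B *v w))"

definition psi :: "real^'n^'n \<Rightarrow> real^'n \<Rightarrow> real^'n \<Rightarrow> real" where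
  "psi M x z = 1/2 * ((x - z) \<bullet> (M *v (x - z)))"

definition dual_op :: "real^'n^'n \<Rightarrow> (real^'n \<Rightarrow> ereal) \<Rightarrow> real^'n \<Rightarrow> ereal" where
  "dual_op M \<phi> z = - (SUP x. ereal (psi M x z) - \<phi> x)"

definition aux_value ::
  "real^'n^'n \<Rightarrow> real^'m^'n \<Rightarrow> real^'n^'n \<Rightarrow> real \<Rightarrow> real^'n^'n
     \<Rightarrow> nat \<Rightarrow> real^'n \<Rightarrow> real^'n \<Rightarrow> ereal" where
  "aux_value A B \<Phi> \<gamma> M k x z = (dp_op A B \<Phi> \<gamma> ^^ k) (\<lambda>x'. ereal (psi M x' z)) x"

definition dual_kernel ::
  "real^'n^'n \<Rightarrow> real^'m^'n \<Rightarrow> real^'n^'n \<Rightarrow> real \<Rightarrow> real^'n^'n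
     \<Rightarrow> nat \<Rightarrow> real^'n \<Rightarrow> real^'n \<Rightarrow> ereal" where
  "dual_kernel A B \<Phi> \<gamma> M k y z = dual_op M (\<lambda>x. aux_value A B \<Phi> \<gamma> M k x z) y"

definition primal_kernel ::
  "real^'n^'n \<Rightarrow> real^'m^'n \<Rightarrow> real^'n^'n \<Rightarrow> real \<Rightarrow> real^'n^'n
     \<Rightarrow> nat \<Rightarrow> real^'n \<Rightarrow> real^'n \<Rightarrow> ereal" where
  "primal_kernel A B \<Phi> \<gamma> M k x y = dual_op M (\<lambda>z. aux_value A B \<Phi> \<gamma> M k x z) y"

(* Vectors and matrices of size 2n are indexed by the sum type 'n + 'n. *)
definition stack :: "real^'n \<Rightarrow> real^'n \<Rightarrow> real^('n::finite + 'n)" where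
  "stack y z = (\<chi> i. case i of Inl a \<Rightarrow> y $ a | Inr b \<Rightarrow> z $ b)"

definition blk11 :: "real^('n::finite + 'n)^('n + 'n) \<Rightarrow> real^'n^'n" where
  "blk11 \<Omega> = (\<chi> i j. \<Omega> $ Inl i $ Inl j)"

definition blk12 :: "real^('n::finite + 'n)^('n + 'n) \<Rightarrow> real^'n^'n" where
  "blk12 \<Omega> = (\<chi> i j. \<Omega> $ Inl i $ Inr j)"

definition blk21 :: "real^('n::finite + 'n)^('n + 'n) \<Rightarrow> real^'n^'n" where
  "blk21 \<Omega> = (\<chi> i j. \<Omega> $ Inr i $ Inl j)"

definition blk22 :: "real^('n::finite + 'n)^('n + 'n) \<Rightarrow> real^'n^'n" where
  "blk22 \<Omega> = (\<chi> i j. \<Omega> $ Inr i $ Inr j)"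

definition block ::
  "real^'n^'n \<Rightarrow> real^'n^'n \<Rightarrow> real^'n^'n \<Rightarrow> real^'n^'n \<Rightarrow> real^('n::finite + 'n)^('n + 'n)" where
  "block P Q R S =
     (\<chi> i j. case i of
        Inl a \<Rightarrow> (case j of Inl b \<Rightarrow> P $ a $ b | Inr b \<Rightarrow> Q $ a $ b)
      | Inr a \<Rightarrow> (case j of Inl b \<Rightarrow> R $ a $ b | Inr b \<Rightarrow> S $ a $ b))"

definition represents ::
  "real^('n::finite + 'n)^('n + 'n) \<Rightarrow> (real^'n \<Rightarrow> real^'n \<Rightarrow> ereal) \<Rightarrow> bool" where
  "represents \<Omega> K \<longleftrightarrow>
     sym_mat \<Omega> \<and> (\<forall>y z. K y z = ereal (1/2 * (stack y z \<bullet> (\<Omega> *v stack y z))))"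

(* A symmetric matrix is determined by its quadratic form, so the descriptions below denote
   as soon as the kernels are quadratic forms. *)
definition Theta ::
  "real^'n^'n \<Rightarrow> real^'m^'n \<Rightarrow> real^'n^'n \<Rightarrow> real \<Rightarrow> real^'n^'n
     \<Rightarrow> nat \<Rightarrow> real^('n::finite + 'n)^('n + 'n)" where
  "Theta A B \<Phi> \<gamma> M k = (THE \<Omega>. represents \<Omega> (dual_kernel A B \<Phi> \<gamma> M k))"

definition Lambda ::
  "real^'n^'n \<Rightarrow> real^'m^'n \<Rightarrow> real^'n^'n \<Rightarrow> real \<Rightarrow> real^'n^'n
     \<Rightarrow> nat \<Rightarrow> real^('n::finite + 'n)^('n + 'n)" where
  "Lambda A B \<Phi> \<gamma> M k = (THE \<Omega>. represents \<Omega> (primal_kernel A B \<Phi> \<gamma> M k))"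

(* The operators \<Gamma>, \<Pi>, \<Pi>^{-1} and \<Xi> are partial maps; None means outside the domain. *)
definition Gamma_op ::
  "real^'n^'n \<Rightarrow> real^('n::finite + 'n)^('n + 'n) \<rightharpoonup> real^('n::finite + 'n)^('n + 'n)" where
  "Gamma_op M \<Omega> =
     (if sym_mat \<Omega> \<and> neg_def (blk11 \<Omega> + M) then
        let N = matrix_inv (M + blk11 \<Omega>) in
        Some (block (M - M ** N ** M) (M ** N ** blk12 \<Omega>)
                    (blk21 \<Omega> ** N ** M) (blk22 \<Omega> - blk21 \<Omega> ** N ** blk12 \<Omega>))
      else None)"

definition Delta_op :: "real^('n::finite + 'n)^('n + 'n) \<Rightarrow> real^('n::finite + 'n)^('n + 'n)" where
  "Delta_op \<Omega> = block (blk22 \<Omega>) (blk21 \<Omega>) (blk12 \<Omega>) (blk11 \<Omega>)"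

definition Pi_op ::
  "real^'n^'n \<Rightarrow> real^('n::finite + 'n)^('n + 'n) \<rightharpoonup> real^('n::finite + 'n)^('n + 'n)" where
  "Pi_op M \<Omega> = map_option Delta_op (Gamma_op M (Delta_op \<Omega>))"

(* The domain, M - \<Omega>^22 < 0, is inherited from that of Pi_op at - \<Omega>. *)
definition Pi_inv_op ::
  "real^'n^'n \<Rightarrow> real^('n::finite + 'n)^('n + 'n) \<rightharpoonup> real^('n::finite + 'n)^('n + 'n)" where
  "Pi_inv_op M \<Omega> = map_option uminus (Pi_op M (- \<Omega>))"

definition Xi_op ::
  "real^'n^'n \<Rightarrow> real^('n::finite + 'n)^('n + 'n) \<rightharpoonup> real^('n::finite + 'n)^('n + 'n)" where
  "Xi_op M = Pi_inv_op M \<circ>\<^sub>m Gamma_op M"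

end

theory Submission
  imports Defs
begin

text \<open>
  The auxiliary value function \<open>aux_value \<dots> k x z\<close> is a quadratic form in the pair \<open>(x, z)\<close>, with a
  symmetric matrix \<open>Q\<close>, because dynamic programming preserves such forms: each step maximises a
  strictly concave quadratic in \<open>w\<close> (\<open>SUP_concave_quadratic\<close>, \<open>represents_dp_op\<close>), and the concavity is
  exactly the gain condition on the Riccati iterates, which are the blocks \<open>blk11 Q\<close>.  Both
  fundamental solutions are obtained from this one matrix by semiconvex duality, \<open>\<Theta>\<close> by dualising
  the first variable and \<open>\<Lambda>\<close> by dualising the second.

  Completing the square shows that dualising the first variable is the matrix map
  \<open>Q \<mapsto> - \<Gamma> (- Q)\<close> (\<open>represents_dual_op\<close>).  Exchanging the two variables conjugates this map by
  \<open>\<Delta>\<close>, so that dualising the second variable is \<open>Q \<mapsto> - \<Pi> (- Q) = \<Pi>\<^sup>-\<^sup>1 Q\<close>.  On the other hand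
  \<open>Q \<mapsto> - \<Gamma> (- Q)\<close> is inverted by \<open>\<Gamma>\<close> (\<open>Gamma_op_involution\<close>).  Hence \<open>\<Gamma> \<Theta> = Q\<close> and
  \<open>\<Lambda> = \<Pi>\<^sup>-\<^sup>1 Q = \<Pi>\<^sup>-\<^sup>1 (\<Gamma> \<Theta>) = \<Xi> \<Theta>\<close>.

  It remains to see that the two dualisations are legitimate, that is, that \<open>blk11 Q > M\<close> and
  \<open>blk22 Q > M\<close>.  Both follow from monotonicity of the value function in \<open>k\<close>, along \<open>z = 0\<close> for the
  first (\<open>riccati_iterate_gt\<close>) and along \<open>x = 0\<close> for the second (\<open>aux_value_blk22_gt\<close>); the strict
  inequality is gained in the first step.
\<close>

section \<open>Symmetric and definite matrices\<close>

lemma inner_transpose_matrix_vector: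
  fixes A :: "real^'n^'m"
  shows "(transpose A *v x) \<bullet> y = x \<bullet> (A *v y)"
  by (simp add: dot_lmul_matrix)

lemma matrix_vector_mult_uminus: "(- A) *v x = - (A *v x)"
  for A :: "real^'n^'m"
  by (simp add: vec_eq_iff matrix_vector_mult_def sum_negf)

lemma matrix_mult_uminus_left: "(- A) ** B = - (A ** B)"
  and matrix_mult_uminus_right: "A ** (- B) = - (A ** B)"
  for A :: "real^'n^'m" and B :: "real^'k^'n"
  by (simp_all add: vec_eq_iff matrix_matrix_mult_def sum_negf)

lemma transpose_add: "transpose (A + B) = transpose A + transpose B"
  and transpose_diff: "transpose (A - B) = transpose A - transpose B"
  and transpose_uminus: "transpose (- A) = - transpose A"
  for A B :: "real^'n^'m"
  by (simp_all add: vec_eq_iff transpose_def)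

lemma sym_mat_inner: "sym_mat P \<Longrightarrow> (P *v x) \<bullet> y = x \<bullet> (P *v y)"
  using inner_transpose_matrix_vector[of P x y] by (simp add: sym_mat_def)

lemma sym_mat_add: "sym_mat P \<Longrightarrow> sym_mat Q \<Longrightarrow> sym_mat (P + Q)"
  and sym_mat_diff: "sym_mat P \<Longrightarrow> sym_mat Q \<Longrightarrow> sym_mat (P - Q)"
  and sym_mat_uminus: "sym_mat P \<Longrightarrow> sym_mat (- P)"
  by (simp_all add: sym_mat_def transpose_add transpose_diff transpose_uminus)

lemma sym_mat_congruence: "sym_mat P \<Longrightarrow> sym_mat (transpose C ** P ** C)"
  by (simp add: sym_mat_def matrix_transpose_mul matrix_mul_assoc)

text \<open>
  Polarisation: the form at \<open>u + v\<close> recovers the bilinear form, which separates matrices.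
\<close>

lemma sym_mat_eq_0:
  assumes "sym_mat P" "\<And>v. v \<bullet> (P *v v) = 0"
  shows "P = 0"
proof -
  have "u \<bullet> (P *v v) = 0" for u v
    using assms(2)[of "u + v"] assms(2)[of u] assms(2)[of v] sym_mat_inner[OF assms(1), of v u]
    by (simp add: inner_commute algebra_simps)
  then have "P *v v = 0 *v v" for v
    by (metis inner_eq_zero_iff matrix_vector_mult_0)
  then show ?thesis
    by (simp add: matrix_eq)
qed

lemma matrix_inv_cancel:
  assumes "invertible K"
  shows "matrix_inv K ** K = mat 1" and "K ** matrix_inv K = mat 1"
  using someI_ex[OF assms[unfolded invertible_def]] by (simp_all add: matrix_inv_def)

lemma matrix_inv_unique:
  fixes K :: "real^'n^'n"
  assumes "K ** N = mat 1"
  shows "matrix_inv K = N"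
proof -
  have "invertible K"
    using assms by (auto simp: invertible_right_inverse)
  then have "matrix_inv K ** (K ** N) = N"
    by (simp add: matrix_mul_assoc matrix_inv_cancel)
  then show ?thesis
    by (simp add: assms)
qed

lemma matrix_inv_vector:
  fixes K :: "real^'n^'n"
  assumes "invertible K"
  shows "matrix_inv K *v (K *v x) = x" and "K *v (matrix_inv K *v x) = x"
  by (simp_all add: matrix_vector_mul_assoc matrix_inv_cancel assms)

lemma matrix_inv_uminus:
  fixes K :: "real^'n^'n"
  assumes "invertible K"
  shows "matrix_inv (- K) = - matrix_inv K"
  by (rule matrix_inv_unique)
    (simp add: matrix_mult_uminus_left matrix_mult_uminus_right matrix_inv_cancel assms)

lemma invertible_if_quadratic_nonzero:
  fixes K :: "real^'n^'n"
  assumes "\<And>x. x \<noteq> 0 \<Longrightarrow> x \<bullet> (K *v x) \<noteq> 0"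
  shows "invertible K"
  unfolding invertible_left_inverse matrix_left_invertible_ker
  by (metis assms inner_zero_right)

lemma pos_def_invertible: "pos_def K \<Longrightarrow> invertible K"
  by (rule invertible_if_quadratic_nonzero) (metis pos_def_def less_irrefl)

lemma sym_mat_matrix_inv:
  fixes K :: "real^'n^'n"
  assumes "sym_mat K" "invertible K"
  shows "sym_mat (matrix_inv K)"
proof -
  have "K ** transpose (matrix_inv K) = transpose (matrix_inv K ** K)"
    using assms(1) by (simp add: matrix_transpose_mul sym_mat_def)
  also have "\<dots> = mat 1"
    by (simp add: assms matrix_inv_cancel)
  finally have "matrix_inv K = transpose (matrix_inv K)"
    by (rule matrix_inv_unique)
  then show ?thesis
    by (simp add: sym_mat_def)
qed

lemma pos_def_matrix_inv:
  assumes "pos_def K"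
  shows "pos_def (matrix_inv K)"
proof -
  note inv = pos_def_invertible[OF assms]
  have "x \<bullet> (matrix_inv K *v x) > 0" if "x \<noteq> 0" for x
  proof -
    define y where "y = matrix_inv K *v x"
    have x: "x = K *v y"
      by (simp add: y_def matrix_inv_vector inv)
    then have "y \<noteq> 0"
      using that by auto
    then have "0 < y \<bullet> (K *v y)"
      using assms by (simp add: pos_def_def)
    also have "\<dots> = x \<bullet> y"
      by (simp add: x inner_commute)
    finally show ?thesis
      by (simp add: y_def)
  qed
  then show ?thesis
    using assms inv by (simp add: pos_def_def sym_mat_matrix_inv)
qed

lemma neg_def_invertible:
  fixes K :: "real^'n^'n"
  assumes "neg_def K"
  shows "invertible K"
proof (rule invertible_if_quadratic_nonzero)
  fix x :: "real^'n"
  assume "x \<noteq> 0"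
  then have "0 < x \<bullet> (- K *v x)"
    using assms unfolding neg_def_def pos_def_def by blast
  then show "x \<bullet> (K *v x) \<noteq> 0"
    by (simp add: matrix_vector_mult_uminus)
qed

lemma pos_def_congruence:
  fixes P C :: "real^'n^'n"
  assumes "pos_def P" "invertible C"
  shows "pos_def (transpose C ** P ** C)"
proof -
  have "x \<bullet> (transpose C ** P ** C *v x) > 0" if "x \<noteq> 0" for x
  proof -
    have "C *v x \<noteq> 0"
      using that matrix_inv_vector(1)[OF assms(2), of x] by (metis matrix_vector_mult_0_right)
    then have "0 < (C *v x) \<bullet> (P *v (C *v x))"
      using assms(1) by (simp add: pos_def_def)
    also have "\<dots> = x \<bullet> (transpose C ** P ** C *v x)"
      using inner_transpose_matrix_vector[of C "P *v (C *v x)" x]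
      by (simp only: matrix_vector_mul_assoc[symmetric] inner_commute)
    finally show ?thesis .
  qed
  then show ?thesis
    using assms(1) by (simp add: pos_def_def sym_mat_congruence)
qed

section \<open>Suprema of concave quadratics\<close>

text \<open>
  With \<open>b = K *v p\<close>, completing the square turns the objective into its value at the maximiser \<open>p\<close>
  minus the nonnegative quantity \<open>1/2 * ((x - p) \<bullet> (K *v (x - p)))\<close>.
\<close>

lemma SUP_concave_quadratic:
  fixes K :: "real^'n^'n"
  assumes "pos_def K"
  shows "(SUP x. ereal (c + x \<bullet> b - 1/2 * (x \<bullet> (K *v x))))
    = ereal (c + 1/2 * (b \<bullet> (matrix_inv K *v b)))" (is "(SUP x. ?f x) = ?s")
proof (rule antisym)
  define p where "p = matrix_inv K *v b"
  have b: "b = K *v p"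
    by (simp add: p_def matrix_inv_vector pos_def_invertible assms)
  have f: "?f x = ereal (c + 1/2 * (p \<bullet> (K *v p)) - 1/2 * ((x - p) \<bullet> (K *v (x - p))))" for x
    using sym_mat_inner[of K p x] assms
    by (simp add: b pos_def_def inner_commute algebra_simps)
  have "b \<bullet> p = p \<bullet> (K *v p)"
    by (simp add: b inner_commute)
  then have s: "?s = ereal (c + 1/2 * (p \<bullet> (K *v p)))"
    by (simp add: p_def)
  show "(SUP x. ?f x) \<le> ?s"
  proof (rule SUP_least)
    fix x
    have "0 \<le> (x - p) \<bullet> (K *v (x - p))"
      using assms by (cases "x = p") (auto simp: pos_def_def intro: less_imp_le)
    then show "?f x \<le> ?s"
      unfolding f s by simp
  qed
  have "?s = ?f p"
    unfolding f s by simp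
  also have "\<dots> \<le> (SUP x. ?f x)"
    by (rule SUP_upper) simp
  finally show "?s \<le> (SUP x. ?f x)" .
qed

section \<open>Quadratic forms in block coordinates\<close>

lemma sum_UNIV_Plus:
  fixes f :: "('a::finite + 'b::finite) \<Rightarrow> real"
  shows "sum f UNIV = (\<Sum>a\<in>UNIV. f (Inl a)) + (\<Sum>b\<in>UNIV. f (Inr b))"
  using sum.Plus[of "UNIV :: 'a set" "UNIV :: 'b set" f] by (simp add: comp_def)

lemma inner_stack: "stack y z \<bullet> stack y' z' = y \<bullet> y' + z \<bullet> z'"
  by (simp add: stack_def inner_vec_def sum_UNIV_Plus)

lemma block_mult_stack:
  "block P Q R S *v stack y z = stack (P *v y + Q *v z) (R *v y + S *v z)"
  by (simp add: block_def stack_def vec_eq_iff matrix_vector_mult_def sum_UNIV_Plus split: sum.split)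

lemma block_inject: "block P Q R S = block P' Q' R' S' \<longleftrightarrow> P = P' \<and> Q = Q' \<and> R = R' \<and> S = S'"
  by (auto simp: block_def vec_eq_iff split: sum.splits)

lemma blk_block [simp]:
  "blk11 (block P Q R S) = P" "blk12 (block P Q R S) = Q"
  "blk21 (block P Q R S) = R" "blk22 (block P Q R S) = S"
  by (simp_all add: block_def blk11_def blk12_def blk21_def blk22_def vec_eq_iff)

lemma block_blk: "block (blk11 \<Omega>) (blk12 \<Omega>) (blk21 \<Omega>) (blk22 \<Omega>) = \<Omega>"
  by (simp add: block_def blk11_def blk12_def blk21_def blk22_def vec_eq_iff split: sum.split)

lemma block_uminus: "- block P Q R S = block (- P) (- Q) (- R) (- S)"
  by (simp add: block_def vec_eq_iff split: sum.split)

lemma blk_uminus [simp]: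
  "blk11 (- \<Omega>) = - blk11 \<Omega>" "blk12 (- \<Omega>) = - blk12 \<Omega>"
  "blk21 (- \<Omega>) = - blk21 \<Omega>" "blk22 (- \<Omega>) = - blk22 \<Omega>"
  by (simp_all add: blk11_def blk12_def blk21_def blk22_def vec_eq_iff)

lemma transpose_block:
  "transpose (block P Q R S) = block (transpose P) (transpose R) (transpose Q) (transpose S)"
  by (simp add: block_def transpose_def vec_eq_iff split: sum.split)

lemma sym_mat_block:
  "sym_mat (block P Q R S) \<longleftrightarrow> sym_mat P \<and> R = transpose Q \<and> sym_mat S"
  by (auto simp: sym_mat_def transpose_block block_inject)

lemma sym_mat_blk:
  assumes "sym_mat \<Omega>"
  shows "sym_mat (blk11 \<Omega>)" "blk21 \<Omega> = transpose (blk12 \<Omega>)" "sym_mat (blk22 \<Omega>)"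
  using assms by (subst (asm) block_blk[symmetric], simp add: sym_mat_block)+

lemma represents_block_iff:
  "represents (block P Q (transpose Q) S) K \<longleftrightarrow> sym_mat P \<and> sym_mat S \<and>
    (\<forall>y z. K y z = ereal (1/2 * (y \<bullet> (P *v y)) + y \<bullet> (Q *v z) + 1/2 * (z \<bullet> (S *v z))))"
proof -
  have "z \<bullet> (transpose Q *v y) = y \<bullet> (Q *v z)" for y z
    using inner_transpose_matrix_vector[of Q y z] by (simp add: inner_commute)
  then show ?thesis
    by (auto simp: represents_def sym_mat_block block_mult_stack inner_stack inner_add_right
        algebra_simps simp del: transpose_matrix_vector)
qed

lemma represents_iff:
  "represents \<Omega> K \<longleftrightarrow> sym_mat \<Omega> \<and>
    (\<forall>y z. K y z = ereal (1/2 * (y \<bullet> (blk11 \<Omega> *v y)) + y \<bullet> (blk12 \<Omega> *v z)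
      + 1/2 * (z \<bullet> (blk22 \<Omega> *v z))))"
proof (cases "sym_mat \<Omega>")
  case True
  show ?thesis
    using represents_block_iff[of "blk11 \<Omega>" "blk12 \<Omega>" "blk22 \<Omega>" K] block_blk[of \<Omega>]
      sym_mat_blk[OF True] True by simp
qed (simp add: represents_def)

lemma stack_surj: "\<exists>y z. v = stack y z"
proof (intro exI)
  show "v = stack (\<chi> a. v $ Inl a) (\<chi> b. v $ Inr b)"
    by (simp add: stack_def vec_eq_iff split: sum.split)
qed

text \<open>
  The quadratic form determines the symmetric matrix, which makes the definite descriptions in
  \<open>Theta\<close> and \<open>Lambda\<close> meaningful.
\<close>

lemma represents_unique:
  assumes "represents \<Omega> K" "represents \<Omega>' K"
  shows "\<Omega> = \<Omega>'"
proof -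
  have "v \<bullet> ((\<Omega> - \<Omega>') *v v) = 0" for v
  proof -
    obtain y z where v: "v = stack y z"
      using stack_surj by blast
    have "K y z = ereal (1/2 * (v \<bullet> (\<Omega> *v v)))" "K y z = ereal (1/2 * (v \<bullet> (\<Omega>' *v v)))"
      using assms by (auto simp: represents_def v)
    then show ?thesis
      by (simp add: algebra_simps)
  qed
  then have "\<Omega> - \<Omega>' = 0"
    using assms by (intro sym_mat_eq_0) (auto simp: represents_def intro: sym_mat_diff)
  then show ?thesis
    by simp
qed

lemma the_represents: "represents \<Omega> K \<Longrightarrow> (THE \<Omega>. represents \<Omega> K) = \<Omega>"
  using represents_unique by blast

text \<open>
  \<open>\<Delta>\<close> is the exchange of the two arguments of a quadratic form; it transfers every fact about
  dualising the first argument to the second.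
\<close>

lemma represents_Delta:
  assumes "represents \<Omega> K"
  shows "represents (Delta_op \<Omega>) (\<lambda>z y. K y z)"
proof -
  have s: "sym_mat \<Omega>"
    using assms by (simp add: represents_def)
  have "y \<bullet> (blk12 \<Omega> *v z) = z \<bullet> (transpose (blk12 \<Omega>) *v y)" for y z
    using inner_transpose_matrix_vector[of "blk12 \<Omega>" y z] by (simp add: inner_commute)
  then show ?thesis
    using assms sym_mat_blk[OF s]
    by (simp add: represents_iff Delta_op_def sym_mat_block algebra_simps del: transpose_matrix_vector)
qed

section \<open>Semiconvex duality and the map \<Gamma>\<close>

text \<open>
  The part of \<open>psi M x y - K x z\<close> that is quadratic in \<open>x\<close> has the matrix \<open>M - blk11 Q\<close>, so the domain
  of \<open>\<Gamma>\<close> at \<open>- Q\<close> is what makes the supremum over \<open>x\<close> a concave maximisation.  Its value is a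
  Schur complement with respect to that block, and the outer minus sign in the dual accounts for
  the outer minus sign in \<open>- G\<close>.
\<close>

lemma represents_dual_op:
  assumes M: "sym_mat M" and rep: "represents Q K" and G: "Gamma_op M (- Q) = Some G"
  shows "represents (- G) (\<lambda>y z. dual_op M (\<lambda>x. K x z) y)"
proof -
  define P C S where "P = blk11 Q" and "C = blk12 Q" and "S = blk22 Q"
  define N where "N = matrix_inv (M - P)"
  have Q: "sym_mat Q"
    using rep by (simp add: represents_def)
  have P: "sym_mat P" and S: "sym_mat S" and C21: "blk21 Q = transpose C"
    using sym_mat_blk[OF Q] by (simp_all add: P_def S_def C_def)
  have neg: "neg_def (M - P)"
    using G by (auto simp: Gamma_op_def P_def split: if_splits)
  have pos: "pos_def (P - M)"
    using neg by (simp add: neg_def_def)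
  have N': "matrix_inv (P - M) = - N"
    using matrix_inv_uminus[OF neg_def_invertible[OF neg]] by (simp add: N_def)
  have N: "sym_mat N"
    using N' pos_def_matrix_inv[OF pos] sym_mat_uminus[of "- N"] by (simp add: pos_def_def)
  have "- G = - block (M - M ** N ** M) (M ** N ** (- C)) ((- transpose C) ** N ** M)
      (- S - (- transpose C) ** N ** (- C))"
    using G by (auto simp: Gamma_op_def Let_def C21 N_def P_def C_def S_def split: if_splits)
  also have "\<dots> = block (M ** N ** M - M) (M ** N ** C) (transpose (M ** N ** C))
      (S + transpose C ** N ** C)"
    using M N
    by (simp add: block_uminus matrix_mult_uminus_left matrix_mult_uminus_right
        matrix_transpose_mul sym_mat_def matrix_mul_assoc) (simp add: add.commute)
  finally have G': "- G = block (M ** N ** M - M) (M ** N ** C) (transpose (M ** N ** C))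
      (S + transpose C ** N ** C)" .
  have "dual_op M (\<lambda>x. K x z) y = ereal (1/2 * (y \<bullet> ((M ** N ** M - M) *v y))
      + y \<bullet> ((M ** N ** C) *v z) + 1/2 * (z \<bullet> ((S + transpose C ** N ** C) *v z)))" for y z
  proof -
    define b where "b = - (M *v y + C *v z)"
    define c where "c = 1/2 * (y \<bullet> (M *v y)) - 1/2 * (z \<bullet> (S *v z))"
    have "ereal (psi M x y) - K x z = ereal (c + x \<bullet> b - 1/2 * (x \<bullet> ((P - M) *v x)))" for x
      using rep sym_mat_inner[OF M, of x y]
      by (simp add: represents_iff psi_def b_def c_def P_def C_def S_def inner_commute algebra_simps)
    then have "dual_op M (\<lambda>x. K x z) y = - ereal (c + 1/2 * (b \<bullet> (- N *v b)))"
      using SUP_concave_quadratic[OF pos, of c b] by (simp add: dual_op_def N')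
    also have "\<dots> = ereal (1/2 * (b \<bullet> (N *v b)) - c)"
      by (simp add: matrix_vector_mult_uminus)
    also have "1/2 * (b \<bullet> (N *v b)) - c = 1/2 * (y \<bullet> ((M ** N ** M - M) *v y))
      + y \<bullet> ((M ** N ** C) *v z) + 1/2 * (z \<bullet> ((S + transpose C ** N ** C) *v z))"
    proof -
      have 1: "u \<bullet> (M *v v) = (M *v u) \<bullet> v" "z \<bullet> (transpose C *v v) = (C *v z) \<bullet> v" for u v
        using inner_transpose_matrix_vector[of C v z] sym_mat_inner[OF M]
        by (simp_all add: inner_commute)
      have 2: "(C *v z) \<bullet> (N *v (M *v y)) = (M *v y) \<bullet> (N *v (C *v z))"
        using sym_mat_inner[OF N] by (simp add: inner_commute)
      have "b \<bullet> (N *v b) = (M *v y) \<bullet> (N *v (M *v y)) + 2 * ((M *v y) \<bullet> (N *v (C *v z)))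
          + (C *v z) \<bullet> (N *v (C *v z))"
        by (simp add: b_def 2 linear_neg[OF matrix_vector_mul_linear] inner_add_left inner_add_right
            matrix_vector_right_distrib inner_diff_left inner_diff_right matrix_vector_mult_diff_distrib)
      then show ?thesis
        by (simp add: c_def matrix_vector_mul_assoc[symmetric] matrix_vector_mult_add_rdistrib
            matrix_vector_mult_diff_rdistrib inner_add_right inner_diff_right 1 add_divide_distrib
            diff_divide_distrib del: transpose_matrix_vector)
    qed
    finally show ?thesis .
  qed
  then show ?thesis
    unfolding G' using M N S sym_mat_congruence[OF N, of M] sym_mat_congruence[OF N, of C]
    by (simp add: represents_block_iff sym_mat_def transpose_add transpose_diff
       del: transpose_matrix_vector)
qed

text \<open>
  With \<open>N = (M + \<Omega>\<^sup>1\<^sup>1)\<^sup>-\<^sup>1\<close>, the matrix to be inverted in the second application of \<open>\<Gamma>\<close> is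
  \<open>M - (M - M N M) = M N M\<close>.  Its inverse is \<open>M\<^sup>-\<^sup>1 (M + \<Omega>\<^sup>1\<^sup>1) M\<^sup>-\<^sup>1\<close>, whose outer factors cancel
  against those introduced by the first application.  At the level of functions this says that
  the dual transform can be undone, which needs an invertible \<open>M\<close>.
\<close>

lemma Gamma_op_involution:
  assumes M: "sym_mat M" "invertible M" and G: "Gamma_op M \<Omega> = Some G"
  shows "Gamma_op M (- G) = Some (- \<Omega>)"
proof -
  define H where "H = M + blk11 \<Omega>"
  define N where "N = matrix_inv H"
  define M' where "M' = matrix_inv M"
  have \<Omega>: "sym_mat \<Omega>" and neg: "neg_def H"
    using G by (auto simp: Gamma_op_def H_def add.commute split: if_splits)
  have H: "invertible H"
    by (rule neg_def_invertible[OF neg])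
  have Geq: "G = block (M - M ** N ** M) (M ** N ** blk12 \<Omega>)
       (blk21 \<Omega> ** N ** M) (blk22 \<Omega> - blk21 \<Omega> ** N ** blk12 \<Omega>)"
    using G by (auto simp: Gamma_op_def Let_def N_def H_def split: if_splits)
  have Npos: "pos_def (- N)"
    using pos_def_matrix_inv[of "- H"] neg matrix_inv_uminus[OF H] by (simp add: neg_def_def N_def)
  have Nsym: "sym_mat N"
    using Npos sym_mat_uminus[of "- N"] by (simp add: pos_def_def)
  have sum: "M + blk11 (- G) = M ** N ** M"
    by (simp add: Geq)
  have "- (M ** N ** M) = transpose M ** (- N) ** M"
    using M(1) by (simp add: sym_mat_def matrix_mult_uminus_left matrix_mult_uminus_right)
  then have neg': "neg_def (blk11 (- G) + M)"
    using pos_def_congruence[OF Npos M(2)] sum by (simp add: neg_def_def add.commute)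
  have symG: "sym_mat (- G)"
    using M(1) Nsym \<Omega> sym_mat_blk[OF \<Omega>] sym_mat_congruence[OF Nsym, of M]
      sym_mat_congruence[OF Nsym, of "blk12 \<Omega>"]
    by (intro sym_mat_uminus, unfold Geq sym_mat_block)
       (simp add: sym_mat_def matrix_transpose_mul matrix_mul_assoc transpose_diff)
  note cancel = matrix_inv_vector[OF M(2), folded M'_def] matrix_inv_vector[OF H, folded N_def]
  have inv: "matrix_inv (M ** N ** M) = M' ** H ** M'"
    by (rule matrix_inv_unique) (simp add: matrix_eq matrix_vector_mul_assoc[symmetric] cancel)
  have prod: "M ** (M' ** H ** M') ** M = H" "M ** (M' ** H ** M') ** (M ** N ** X) = X"
    "Y ** N ** M ** (M' ** H ** M') ** M = Y" for X Y
    by (simp_all add: matrix_eq matrix_vector_mul_assoc[symmetric] cancel)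
  have "blk21 \<Omega> ** N ** M ** (M' ** H ** M') ** (M ** N ** blk12 \<Omega>) = blk21 \<Omega> ** N ** blk12 \<Omega>"
    by (simp add: matrix_eq matrix_vector_mul_assoc[symmetric] cancel)
  then have "Gamma_op M (- G) = Some (block (M - H) (- blk12 \<Omega>) (- blk21 \<Omega>) (- blk22 \<Omega>))"
    using symG neg' by (simp add: Gamma_op_def inv Geq prod Let_def matrix_mult_uminus_left
        matrix_mult_uminus_right)
  also have "M - H = - blk11 \<Omega>"
    by (simp add: H_def)
  also have "Some (block (- blk11 \<Omega>) (- blk12 \<Omega>) (- blk21 \<Omega>) (- blk22 \<Omega>)) = Some (- \<Omega>)"
    by (simp add: block_uminus[symmetric] block_blk)
  finally show ?thesis .
qed

section \<open>Quadratic value functions under dynamic programming\<close>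

text \<open>
  Written as a sum of congruences, the Riccati operator visibly preserves symmetry.
\<close>

lemma riccati_eq:
  fixes A \<Phi> P :: "real^'n^'n" and B :: "real^'m^'n" and \<gamma> :: real
  assumes "sym_mat P"
  defines "F \<equiv> B ** matrix_inv (mat (\<gamma>\<^sup>2) - transpose B ** P ** B) ** transpose B"
  shows "riccati A B \<Phi> \<gamma> P
    = \<Phi> + transpose A ** P ** A + transpose (P ** A) ** F ** (P ** A)"
  using assms(1) by (simp add: riccati_def F_def matrix_transpose_mul sym_mat_def matrix_mul_assoc)

lemma inner_mat_scalar: "w \<bullet> (mat c *v w) = c * (norm w)\<^sup>2" for w :: "real^'m"
proof -
  have "mat c *v w = c *\<^sub>R w"
    by (simp add: vec_eq_iff matrix_vector_mult_def mat_def if_distrib if_distribR cong: if_cong)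
  then show ?thesis
    by (simp add: power2_norm_eq_inner)
qed

text \<open>
  The objective in \<open>w\<close> has the curvature \<open>- (mat (\<gamma>\<^sup>2) - transpose B ** blk11 Q ** B)\<close>, independent
  of \<open>x\<close> and \<open>z\<close>, while its linear part is \<open>transpose B\<close> applied to \<open>u = P A x + C z\<close>, where
  \<open>P = blk11 Q\<close> and \<open>C = blk12 Q\<close>.  The maximum therefore contributes \<open>1/2 * (u \<bullet> (F *v u))\<close>, and
  the three blocks of the new matrix collect the terms in \<open>(x, x)\<close>, \<open>(x, z)\<close> and \<open>(z, z)\<close>.
\<close>

lemma represents_dp_op:
  fixes A :: "real^'n^'n" and B :: "real^'m^'n" and \<gamma> :: real
  assumes \<Phi>: "sym_mat \<Phi>" and rep: "represents Q K"
    and pos: "pos_def (mat (\<gamma>\<^sup>2) - transpose B ** blk11 Q ** B)"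
  defines "F \<equiv> B ** matrix_inv (mat (\<gamma>\<^sup>2) - transpose B ** blk11 Q ** B) ** transpose B"
  defines "C' \<equiv> transpose A ** (blk12 Q + blk11 Q ** F ** blk12 Q)"
  shows "represents (block (riccati A B \<Phi> \<gamma> (blk11 Q)) C' (transpose C')
      (blk22 Q + transpose (blk12 Q) ** F ** blk12 Q))
    (\<lambda>x z. dp_op A B \<Phi> \<gamma> (\<lambda>x'. K x' z) x)"
proof -
  define P C S where "P = blk11 Q" and "C = blk12 Q" and "S = blk22 Q"
  define W where "W = mat (\<gamma>\<^sup>2) - transpose B ** P ** B"
  define N where "N = matrix_inv W"
  have Q: "sym_mat Q"
    using rep by (simp add: represents_def)
  have P: "sym_mat P" and S: "sym_mat S"
    using sym_mat_blk[OF Q] by (simp_all add: P_def S_def)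
  have W: "pos_def W"
    using pos by (simp add: W_def P_def)
  have F: "F = transpose (transpose B) ** N ** transpose B"
    by (simp add: F_def N_def W_def P_def)
  have Fsym: "sym_mat F"
    using pos_def_matrix_inv[OF W] unfolding F by (intro sym_mat_congruence) (simp add: N_def pos_def_def)
  have ric: "riccati A B \<Phi> \<gamma> P = \<Phi> + transpose A ** P ** A + transpose (P ** A) ** F ** (P ** A)"
    using riccati_eq[OF P] by (simp add: F_def P_def)
  have C': "C' = transpose A ** (C + P ** F ** C)"
    by (simp add: C'_def P_def C_def)
  have "dp_op A B \<Phi> \<gamma> (\<lambda>x'. K x' z) x = ereal (1/2 * (x \<bullet> (riccati A B \<Phi> \<gamma> P *v x))
      + x \<bullet> (C' *v z) + 1/2 * (z \<bullet> ((S + transpose C ** F ** C) *v z)))" for x z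
  proof -
    define v where "v = A *v x"
    define u where "u = P *v v + C *v z"
    define b where "b = transpose B *v u"
    define c where "c = 1/2 * (x \<bullet> (\<Phi> *v x)) + 1/2 * (v \<bullet> (P *v v)) + v \<bullet> (C *v z)
      + 1/2 * (z \<bullet> (S *v z))"
    have "ereal (1/2 * (x \<bullet> (\<Phi> *v x)) - \<gamma>\<^sup>2 / 2 * (norm w)\<^sup>2) + K (A *v x + B *v w) z
        = ereal (c + w \<bullet> b - 1/2 * (w \<bullet> (W *v w)))" for w
    proof -
      have "w \<bullet> b = (B *v w) \<bullet> u"
        using inner_transpose_matrix_vector[of B u w] by (simp add: b_def inner_commute)
      also have "\<dots> = (B *v w) \<bullet> (P *v v) + (B *v w) \<bullet> (C *v z)"
        by (simp add: u_def inner_add_right)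
      finally have wb: "w \<bullet> b = (B *v w) \<bullet> (P *v v) + (B *v w) \<bullet> (C *v z)" .
      have wW: "w \<bullet> (W *v w) = \<gamma>\<^sup>2 * (norm w)\<^sup>2 - (B *v w) \<bullet> (P *v (B *v w))"
        using inner_transpose_matrix_vector[of B "P *v (B *v w)" w]
        by (simp add: W_def matrix_vector_mult_diff_rdistrib inner_diff_right inner_mat_scalar
            matrix_vector_mul_assoc[symmetric] inner_commute del: transpose_matrix_vector)
      have "v \<bullet> (P *v (B *v w)) = (B *v w) \<bullet> (P *v v)"
        using sym_mat_inner[OF P] by (simp add: inner_commute)
      then show ?thesis
        using rep unfolding wb wW
        by (simp add: represents_iff P_def[symmetric] C_def[symmetric] S_def[symmetric] c_def
            v_def[symmetric] algebra_simps inner_add_left inner_add_right)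
    qed
    then have "dp_op A B \<Phi> \<gamma> (\<lambda>x'. K x' z) x = ereal (c + 1/2 * (b \<bullet> (N *v b)))"
      using SUP_concave_quadratic[OF W, of c b] by (simp add: dp_op_def N_def)
    also have "b \<bullet> (N *v b) = u \<bullet> (F *v u)"
      using inner_transpose_matrix_vector[of B u "N *v b"]
      by (simp add: F b_def matrix_vector_mul_assoc[symmetric])
    also have "\<dots> = (P *v v) \<bullet> (F *v (P *v v)) + 2 * ((P *v v) \<bullet> (F *v (C *v z)))
        + (C *v z) \<bullet> (F *v (C *v z))"
      using sym_mat_inner[OF Fsym, of "P *v v" "C *v z"]
      by (simp add: u_def matrix_vector_right_distrib inner_add_left inner_add_right inner_commute)
    also have "c + 1/2 * \<dots> = 1/2 * (x \<bullet> (riccati A B \<Phi> \<gamma> P *v x))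
      + x \<bullet> (C' *v z) + 1/2 * (z \<bullet> ((S + transpose C ** F ** C) *v z))"
    proof -
      have "x \<bullet> (transpose A *v y) = v \<bullet> y" "x \<bullet> (transpose (P ** A) *v y) = (P *v v) \<bullet> y"
        "z \<bullet> (transpose C *v y) = (C *v z) \<bullet> y" "v \<bullet> (P *v y) = (P *v v) \<bullet> y" for y
        using inner_transpose_matrix_vector[of A y x] inner_transpose_matrix_vector[of "P ** A" y x]
          inner_transpose_matrix_vector[of C y z] sym_mat_inner[OF P, of v y]
        by (simp_all add: inner_commute v_def matrix_vector_mul_assoc)
      then show ?thesis
        by (simp add: ric C' c_def matrix_vector_mult_add_rdistrib inner_add_right
            matrix_vector_mul_assoc[symmetric] v_def[symmetric] add_divide_distrib
            del: transpose_matrix_vector)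
    qed
    finally show ?thesis .
  qed
  moreover have "sym_mat (riccati A B \<Phi> \<gamma> P)"
    unfolding ric using \<Phi> P Fsym by (intro sym_mat_add sym_mat_congruence)
  moreover have "sym_mat (S + transpose C ** F ** C)"
    using S Fsym by (intro sym_mat_add sym_mat_congruence)
  ultimately show ?thesis
    by (simp add: represents_block_iff P_def C_def S_def)
qed

lemma dp_op_mono:
  assumes "\<And>x. \<phi> x \<le> \<phi>' x"
  shows "dp_op A B \<Phi> \<gamma> \<phi> x \<le> dp_op A B \<Phi> \<gamma> \<phi>' x"
  unfolding dp_op_def by (intro SUP_mono) (auto intro: add_left_mono assms)

text \<open>
  From the origin the disturbance \<open>w = 0\<close> costs nothing and stays at the origin.
\<close>

lemma dp_op_ge_at_0: "\<phi> 0 \<le> dp_op A B \<Phi> \<gamma> \<phi> 0"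
  unfolding dp_op_def by (rule SUP_upper2[of 0]) (simp_all add: zero_ereal_def[symmetric])

lemma aux_value_0: "aux_value A B \<Phi> \<gamma> M 0 x z = ereal (psi M x z)"
  and aux_value_Suc: "aux_value A B \<Phi> \<gamma> M (Suc k) x z
    = dp_op A B \<Phi> \<gamma> (\<lambda>x'. aux_value A B \<Phi> \<gamma> M k x' z) x"
  by (simp_all add: aux_value_def)

lemma represents_psi:
  assumes "sym_mat M"
  shows "represents (block M (- M) (- M) M) (\<lambda>x z. ereal (psi M x z))"
proof -
  have "psi M y z = 1/2 * (y \<bullet> (M *v y)) + y \<bullet> (- M *v z) + 1/2 * (z \<bullet> (M *v z))" for y z
    using sym_mat_inner[OF assms, of y z]
    by (simp add: psi_def matrix_vector_mult_uminus inner_commute algebra_simps)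
  then show ?thesis
    using represents_block_iff[of M "- M" M] assms
    by (simp add: transpose_uminus sym_mat_def)
qed

context
  fixes A \<Phi> M :: "real^'n^'n" and B :: "real^'m^'n" and \<gamma> :: real
  assumes \<Phi>: "sym_mat \<Phi>" and M: "sym_mat M"
    and gain: "\<And>j. pos_def (mat (\<gamma>\<^sup>2) - transpose B ** (riccati A B \<Phi> \<gamma> ^^ j) M ** B)"
begin

lemma aux_value_quadratic:
  "\<exists>Q. represents Q (aux_value A B \<Phi> \<gamma> M k) \<and> blk11 Q = (riccati A B \<Phi> \<gamma> ^^ k) M"
proof (induction k)
  case 0
  have "represents (block M (- M) (- M) M) (aux_value A B \<Phi> \<gamma> M 0)"
    using represents_psi[OF M] by (simp add: represents_def aux_value_0)
  then show ?case
    by (intro exI[of _ "block M (- M) (- M) M"]) simp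
next
  case (Suc k)
  then obtain Q where Q: "represents Q (aux_value A B \<Phi> \<gamma> M k)"
    "blk11 Q = (riccati A B \<Phi> \<gamma> ^^ k) M"
    by blast
  have "pos_def (mat (\<gamma>\<^sup>2) - transpose B ** blk11 Q ** B)"
    using gain Q(2) by simp
  from represents_dp_op[OF \<Phi> Q(1) this, where A = A] show ?case
    unfolding aux_value_Suc[symmetric] by (intro exI conjI, assumption) (simp add: Q(2))
qed

text \<open>
  The matrix by which the first step raises \<open>M\<close> along \<open>x = 0\<close> is the one whose positive
  definiteness is a standing assumption on \<open>M\<close>.
\<close>

lemma aux_value_1_at_0:
  "aux_value A B \<Phi> \<gamma> M (Suc 0) 0 z = ereal (1/2 * (z \<bullet> ((M
     + M ** B ** matrix_inv (mat (\<gamma>\<^sup>2) - transpose B ** M ** B) ** transpose B ** M) *v z)))"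
proof -
  have "pos_def (mat (\<gamma>\<^sup>2) - transpose B ** blk11 (block M (- M) (- M) M) ** B)"
    using gain[of 0] by simp
  from represents_dp_op[OF \<Phi> represents_psi[OF M] this, where A = A]
  have "dp_op A B \<Phi> \<gamma> (\<lambda>x'. ereal (psi M x' z)) 0 = ereal (1/2 * (z \<bullet> ((M + transpose (- M)
      ** (B ** matrix_inv (mat (\<gamma>\<^sup>2) - transpose B ** M ** B) ** transpose B) ** (- M)) *v z)))"
    by (simp add: represents_iff)
  also have "transpose (- M)
      ** (B ** matrix_inv (mat (\<gamma>\<^sup>2) - transpose B ** M ** B) ** transpose B) ** (- M)
      = M ** B ** matrix_inv (mat (\<gamma>\<^sup>2) - transpose B ** M ** B) ** transpose B ** M"
    using M by (simp add: transpose_uminus sym_mat_def matrix_mult_uminus_left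
        matrix_mult_uminus_right matrix_mul_assoc)
  finally show ?thesis
    by (simp add: aux_value_Suc aux_value_0)
qed

text \<open>
  Monotonicity of the Riccati iteration needs no matrix inequalities: at \<open>z = 0\<close> the value function
  is half the quadratic form of the Riccati iterate, and one application of the monotone operator
  \<open>dp_op\<close> carries each comparison to the next step.
\<close>

lemma riccati_iterate_gt:
  assumes grow: "pos_def (riccati A B \<Phi> \<gamma> M - M)" and "k \<ge> 1"
  shows "pos_def ((riccati A B \<Phi> \<gamma> ^^ k) M - M)"
proof -
  have val: "aux_value A B \<Phi> \<gamma> M j x 0 = ereal (1/2 * (x \<bullet> ((riccati A B \<Phi> \<gamma> ^^ j) M *v x)))"
    for j x
    using aux_value_quadratic[of j] by (force simp: represents_iff)
  have step: "aux_value A B \<Phi> \<gamma> M j x 0 \<le> aux_value A B \<Phi> \<gamma> M (Suc j) x 0" for j x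
  proof (induction j arbitrary: x)
    case 0
    have "0 \<le> x \<bullet> ((riccati A B \<Phi> \<gamma> M - M) *v x)"
      using grow by (cases "x = 0") (auto simp: pos_def_def intro: less_imp_le)
    then show ?case
      unfolding val by (simp add: algebra_simps)
  next
    case (Suc j)
    then show ?case
      unfolding aux_value_Suc[of _ _ _ _ _ "Suc j"] by (subst aux_value_Suc) (rule dp_op_mono)
  qed
  have "x \<bullet> (riccati A B \<Phi> \<gamma> M *v x) \<le> x \<bullet> ((riccati A B \<Phi> \<gamma> ^^ k) M *v x)" for x
    using lift_Suc_mono_le[of "\<lambda>j. aux_value A B \<Phi> \<gamma> M j x 0", OF step \<open>k \<ge> 1\<close>]
    by (simp add: val)
  then have "x \<bullet> (((riccati A B \<Phi> \<gamma> ^^ k) M - M) *v x) > 0" if "x \<noteq> 0" for x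
    using grow that
    by (auto simp: pos_def_def algebra_simps intro: less_le_trans)
  moreover have "sym_mat ((riccati A B \<Phi> \<gamma> ^^ k) M)"
    using aux_value_quadratic[of k] by (metis represents_def sym_mat_blk(1))
  ultimately show ?thesis
    using M by (simp add: pos_def_def sym_mat_diff)
qed

text \<open>
  At \<open>x = 0\<close> the value function is half the quadratic form of \<open>blk22 Q\<close>.  It is nondecreasing in \<open>k\<close>,
  and already strictly above that of \<open>M\<close> after one step.
\<close>

lemma aux_value_blk22_gt:
  assumes pos: "pos_def (M ** B ** matrix_inv (mat (\<gamma>\<^sup>2) - transpose B ** M ** B)
      ** transpose B ** M)"
    and rep: "represents Q (aux_value A B \<Phi> \<gamma> M k)" and "k \<ge> 1"
  shows "pos_def (blk22 Q - M)"
proof -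
  have step: "aux_value A B \<Phi> \<gamma> M j 0 z \<le> aux_value A B \<Phi> \<gamma> M (Suc j) 0 z" for j z
    unfolding aux_value_Suc by (rule dp_op_ge_at_0)
  have "x \<bullet> ((blk22 Q - M) *v x) > 0" if "x \<noteq> 0" for x
  proof -
    have "aux_value A B \<Phi> \<gamma> M (Suc 0) 0 x \<le> aux_value A B \<Phi> \<gamma> M k 0 x"
      using lift_Suc_mono_le[of "\<lambda>j. aux_value A B \<Phi> \<gamma> M j 0 x", OF step] \<open>k \<ge> 1\<close> by simp
    also have "\<dots> = ereal (1/2 * (x \<bullet> (blk22 Q *v x)))"
      using rep by (simp add: represents_iff)
    finally show ?thesis
      using pos that
      by (auto simp: aux_value_1_at_0 pos_def_def algebra_simps intro: less_le_trans)
  qed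
  moreover have "sym_mat (blk22 Q)"
    using rep by (simp add: represents_def sym_mat_blk)
  ultimately show ?thesis
    using M by (simp add: pos_def_def sym_mat_diff)
qed

end

section \<open>The relation between the two semigroups\<close>

theorem theorem6p2:
  fixes A :: "real^'n^'n" and B :: "real^'m^'n" and \<Phi> M :: "real^'n^'n"
    and \<gamma> :: real and k :: nat
  assumes "CARD('m) \<le> CARD('n)"
    and "pos_def \<Phi>"
    and "\<gamma> > 0"
    and "sym_mat M"
    and "\<And>j. pos_def (mat (\<gamma>\<^sup>2) - transpose B ** (riccati A B \<Phi> \<gamma> ^^ j) M ** B)"
    and "pos_def (riccati A B \<Phi> \<gamma> M - M)"
    and "pos_def (M ** B ** matrix_inv (mat (\<gamma>\<^sup>2) - transpose B ** M ** B) ** transpose B ** M)"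
    and "k \<ge> 1"
  shows "Xi_op M (Theta A B \<Phi> \<gamma> M k) = Some (Lambda A B \<Phi> \<gamma> M k)"
proof -
  note M = \<open>sym_mat M\<close>
  have \<Phi>: "sym_mat \<Phi>"
    using assms(2) by (simp add: pos_def_def)
  \<comment> \<open>The last positive definiteness assumption is on a product whose right factor is \<open>M\<close>.\<close>
  have "M *v x \<noteq> 0" if "x \<noteq> 0" for x
  proof
    assume "M *v x = 0"
    then have "x \<bullet> (M ** B ** matrix_inv (mat (\<gamma>\<^sup>2) - transpose B ** M ** B)
        ** transpose B ** M *v x) = 0"
      by (simp add: matrix_vector_mul_assoc[symmetric] del: transpose_matrix_vector)
    then show False
      using assms(7) that by (auto simp: pos_def_def)
  qed
  then have Minv: "invertible M"
    unfolding invertible_left_inverse matrix_left_invertible_ker by blast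
  obtain Q where Q: "represents Q (aux_value A B \<Phi> \<gamma> M k)"
    and Q11: "blk11 Q = (riccati A B \<Phi> \<gamma> ^^ k) M"
    using aux_value_quadratic[OF \<Phi> M assms(5)] by blast
  have Qsym: "sym_mat Q"
    using Q by (simp add: represents_def)
  have Dsym: "sym_mat (Delta_op Q)"
    using represents_Delta[OF Q] by (simp add: represents_def)
  have "pos_def (blk11 Q - M)"
    using riccati_iterate_gt[OF \<Phi> M assms(5,6,8)] by (simp add: Q11)
  then obtain G where G: "Gamma_op M (- Q) = Some G"
    using Qsym by (simp add: Gamma_op_def neg_def_def sym_mat_uminus Let_def)
  have "pos_def (blk22 Q - M)"
    using aux_value_blk22_gt[OF \<Phi> M assms(5,7) Q assms(8)] .
  then obtain L where L: "Gamma_op M (- Delta_op Q) = Some L"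
    using Dsym by (simp add: Gamma_op_def neg_def_def sym_mat_uminus Let_def Delta_op_def)
  have \<Theta>: "Theta A B \<Phi> \<gamma> M k = - G"
    using represents_dual_op[OF M Q G] unfolding Theta_def dual_kernel_def by (rule the_represents)
  have "represents (Delta_op (- L)) (\<lambda>x y. dual_op M (\<lambda>z. aux_value A B \<Phi> \<gamma> M k x z) y)"
    by (rule represents_Delta[OF represents_dual_op[OF M represents_Delta[OF Q] L]])
  then have \<Lambda>: "Lambda A B \<Phi> \<gamma> M k = Delta_op (- L)"
    unfolding Lambda_def primal_kernel_def by (rule the_represents)
  have "Gamma_op M (- G) = Some Q"
    using Gamma_op_involution[OF M Minv G] by simp
  moreover have "Pi_inv_op M Q = Some (Delta_op (- L))"
    using L by (simp add: Pi_inv_op_def Pi_op_def Delta_op_def block_uminus)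
  ultimately show ?thesis
    by (simp add: Xi_op_def \<Theta> \<Lambda> map_comp_def)
qed

end
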